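(* Let $p,q,n$ be positive integers and let $(\mathbf X,\mathbf Y)=\{(X_k,Y_k):k=1,\dots,n\}$ be a random sample from the joint distribution of random vectors $X$ in $\mathbb R^p$ and $Y$ in $\mathbb R^q$. Then $$\mathcal V_n^2(\mathbf X,\mathbf Y)=\|f^n_{X,Y}(t,s)-f^n_X(t)f^n_Y(s)\|^2,$$ where $f^n_{X,Y}$, $f^n_X$, $f^n_Y$ are the joint and marginal empirical characteristic functions of the sample.
   Context: $|\cdot|_d$ is the Euclidean norm on $\mathbb R^d$ and $\langle\cdot,\cdot\rangle$ the scalar product. Empirical distance covariance: for the sample $(X_k,Y_k)$, $k=1,\dots,n$, put $a_{kl}=|X_k-X_l|_p$, $\bar a_{k\cdot}=\frac1n\sum_{l=1}^n a_{kl}$, $\bar a_{\cdot l}=\frac1n\sum_{k=1}^n a_{kl}$, $\bar a_{\cdot\cdot}=\frac1{n^2}\sum_{k,l=1}^n a_{kl}$, $A_{kl}=a_{kl}-\bar a_{k\cdot}-\bar a_{\cdot l}+\bar a_{\cdot\cdot}$; similarly $b_{kl}=|Y_k-Y_l|_q$ and $B_{kl}=b_{kl}-\bar b_{k\cdot}-\bar b_{\cdot l}+\bar b_{\cdot\cdot}$. Then $$\mathcal V_n^2(\mathbf X,\mathbf Y)=\frac1{n^2}\sum_{k,l=1}^n A_{kl}B_{kl}.$$ Empirical characteristic functions: $f^n_{X,Y}(t,s)=\frac1n\sum_{k=1}^n\exp\{i\langle t,X_k\rangle+i\langle s,Y_k\rangle\}$, $f^n_X(t)=\frac1n\sum_{k=1}^n\exp\{i\langle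 t,X_k\rangle\}$, $f^n_Y(s)=\frac1n\sum_{k=1}^n\exp\{i\langle s,Y_k\rangle\}$, for $t\in\mathbb R^p$, $s\in\mathbb R^q$. Norm: for a complex function $\gamma$ on $\mathbb R^p\times\mathbb R^q$, $$\|\gamma(t,s)\|^2=\int_{\mathbb R^{p+q}}\frac{|\gamma(t,s)|^2}{c_pc_q|t|_p^{1+p}|s|_q^{1+q}}\,dt\,ds,\qquad c_d=\frac{\pi^{(1+d)/2}}{\Gamma((1+d)/2)}.$$ *)

theory Defs
  imports "HOL-Probability.Probability"
begin

definition mean_row :: "nat \<Rightarrow> (nat \<Rightarrow> nat \<Rightarrow> real) \<Rightarrow> nat \<Rightarrow> real" where
  "mean_row n a k = (1 / real n) * (\<Sum>l=1..n. a k l)"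

definition mean_col :: "nat \<Rightarrow> (nat \<Rightarrow> nat \<Rightarrow> real) \<Rightarrow> nat \<Rightarrow> real" where
  "mean_col n a l = (1 / real n) * (\<Sum>k=1..n. a k l)"

definition mean_all :: "nat \<Rightarrow> (nat \<Rightarrow> nat \<Rightarrow> real) \<Rightarrow> real" where
  "mean_all n a = (1 / (real n)\<^sup>2) * (\<Sum>k=1..n. \<Sum>l=1..n. a k l)"

definition double_centered :: "nat \<Rightarrow> (nat \<Rightarrow> nat \<Rightarrow> real) \<Rightarrow> nat \<Rightarrow> nat \<Rightarrow> real" where
  "double_centered n a k l = a k l - mean_row n a k - mean_col n a l + mean_all n a"

definition pair_dist :: "(nat \<Rightarrow> real ^ 'd) \<Rightarrow> nat \<Rightarrow> nat \<Rightarrow> real" where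
  "pair_dist x k l = norm (x k - x l)"

definition dcov_sq :: "nat \<Rightarrow> (nat \<Rightarrow> real ^ 'p) \<Rightarrow> (nat \<Rightarrow> real ^ 'q) \<Rightarrow> real" where
  "dcov_sq n x y = (1 / (real n)\<^sup>2) *
     (\<Sum>k=1..n. \<Sum>l=1..n. double_centered n (pair_dist x) k l * double_centered n (pair_dist y) k l)"

definition ecf :: "nat \<Rightarrow> (nat \<Rightarrow> real ^ 'd) \<Rightarrow> real ^ 'd \<Rightarrow> complex" where
  "ecf n x t = (1 / of_nat n) * (\<Sum>k=1..n. exp (\<i> * of_real (t \<bullet> x k)))"

definition joint_ecf ::
  "nat \<Rightarrow> (nat \<Rightarrow> real ^ 'p) \<Rightarrow> (nat \<Rightarrow> real ^ 'q) \<Rightarrow> real ^ 'p \<Rightarrow> real ^ 'q \<Rightarrow> complex" where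
  "joint_ecf n x y t s =
     (1 / of_nat n) * (\<Sum>k=1..n. exp (\<i> * of_real (t \<bullet> x k) + \<i> * of_real (s \<bullet> y k)))"

definition dcov_const :: "nat \<Rightarrow> real" where
  "dcov_const d = pi powr ((1 + real d) / 2) / Gamma ((1 + real d) / 2)"

(* The squared weighted norm may be infinite, hence the value in ennreal. On the null set
   where t = 0 or s = 0 the weight is undefined; there the integrand is 0 by x / 0 = 0. *)
definition weighted_norm_sq :: "(real ^ 'p \<Rightarrow> real ^ 'q \<Rightarrow> complex) \<Rightarrow> ennreal" where
  "weighted_norm_sq \<gamma> =
     (\<integral>\<^sup>+ (t, s). ennreal ((cmod (\<gamma> t s))\<^sup>2 /
        (dcov_const CARD('p) * dcov_const CARD('q) *
         norm t ^ (1 + CARD('p)) * norm s ^ (1 + CARD('q))))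
      \<partial>(lborel :: ((real ^ 'p) \<times> (real ^ 'q)) measure))"

end

theory Submission
  imports Defs
begin

text \<open>
  The identity holds separately for every realization of the sample, so it is a statement about
  finitely many points \<open>x k\<close> and \<open>y k\<close>.

  Everything rests on one integral: in a Euclidean space of dimension \<open>d\<close>, the function
  \<open>1 - cos (t \<bullet> x)\<close> integrated against the weight \<open>1 / (dcov_const d * norm t ^ (1 + d))\<close> gives
  \<open>norm x\<close> (\<open>has_bochner_integral_one_minus_cos\<close>). It is evaluated by writing the weight as a
  mixture of Gaussians \<open>exp (- s * (norm t)\<^sup>2)\<close>, whose Fourier transforms are known
  (\<open>gaussian_fourier\<close>); the integral over \<open>s\<close> that remains is one-dimensional
  (\<open>nn_integral_one_minus_exp_inverse\<close>).

  The difference \<open>f\<^sub>X\<^sub>Y - f\<^sub>X f\<^sub>Y\<close> is an empirical covariance of the characters \<open>cis (t \<bullet> x k)\<close>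
  and \<open>cis (s \<bullet> y k)\<close>. With the centered characters \<open>z k t\<close> and \<open>z' k s\<close> it equals the mean of
  \<open>z k t * z' k s\<close> (\<open>joint_ecf_minus_product\<close>), and its squared modulus is the mean over pairs
  \<open>k, l\<close> of \<open>(z k t * cnj (z l t)) * (z' k s * cnj (z' l s))\<close>: a sum of products of a function of
  \<open>t\<close> and a function of \<open>s\<close>. Against the weight, the first factor integrates to minus the
  double-centered distance of \<open>x k\<close> and \<open>x l\<close>, since centering the characters
  double-centers the matrix of the cosines \<open>cos (t \<bullet> (x k - x l))\<close>
  (\<open>has_bochner_integral_centered_characters\<close>), and likewise for the second factor. Fubini's theorem then produces the products of the two centered distance matrices.
\<close>

section \<open>Two one-dimensional integrals\<close>

text \<open>
  Euler's integral for \<open>Gamma\<close> after the rescaling \<open>s \<mapsto> c * s\<close>. Read from right to left it writes a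
  power \<open>1 / c powr z\<close> as a mixture of exponentials in \<open>c\<close>; with \<open>c = (norm t)\<^sup>2\<close> this is what
  turns the weight \<open>1 / norm t ^ (1 + d)\<close> into a mixture of Gaussians.
\<close>
lemma nn_integral_gamma_kernel:
  fixes z c :: real
  assumes z: "z > 0" and c: "c > 0"
  shows "(\<integral>\<^sup>+s. ennreal (indicator {0..} s * s powr (z - 1) * exp (- c * s)) \<partial>lborel)
           = ennreal (Gamma z / c powr z)"
proof -
  let ?f = "\<lambda>s. ennreal (indicator {0..} s * s powr (z - 1) * exp (- c * s))"
  have eq: "ennreal (indicator {0..} (c * s) * (c * s) powr (z - 1) / exp (c * s))
              = ennreal (c powr (z - 1)) * ?f s" for s
    using c by (auto simp: indicator_def zero_le_mult_iff powr_mult exp_minus field_simps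
        simp flip: ennreal_mult)
  have "ennreal (Gamma z) = ennreal c * (\<integral>\<^sup>+s. ennreal (c powr (z - 1)) * ?f s \<partial>lborel)"
    using c unfolding Gamma_conv_nn_integral_real[OF z]
    by (subst nn_integral_real_affine[where c = c and t = 0]) (simp_all add: eq)
  also have "\<dots> = ennreal (c powr z) * (\<integral>\<^sup>+s. ?f s \<partial>lborel)"
    using c by (subst nn_integral_cmult)
      (simp_all add: ennreal_mult[symmetric] mult.assoc[symmetric] powr_mult_base)
  finally have G: "ennreal (Gamma z) = ennreal (c powr z) * (\<integral>\<^sup>+s. ?f s \<partial>lborel)" .
  have "ennreal (Gamma z / c powr z) = ennreal (1 / c powr z) * ennreal (Gamma z)"
    using c z by (simp flip: ennreal_mult add: Gamma_real_pos)
  also have "\<dots> = (ennreal (1 / c powr z) * ennreal (c powr z)) * (\<integral>\<^sup>+s. ?f s \<partial>lborel)"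
    unfolding G by (simp only: mult.assoc)
  also have "\<dots> = (\<integral>\<^sup>+s. ?f s \<partial>lborel)"
    using c by (simp flip: ennreal_mult)
  finally show ?thesis by simp
qed

text \<open>
  Layer-cake: \<open>1 - exp (- a / s)\<close> is the integral of \<open>exp (- w)\<close> over \<open>0 \<le> w \<le> a / s\<close>. Under
  the double integral this region is \<open>s * w \<le> a\<close>, symmetric in the two variables. Integrating
  \<open>s powr (- 1/2)\<close> over \<open>0 < s \<le> a / w\<close> first gives \<open>2 * sqrt (a / w)\<close>, and what is left is
  \<open>Gamma (1/2)\<close>.
\<close>
lemma nn_integral_one_minus_exp_inverse:
  fixes a :: real
  assumes a: "a \<ge> 0"
  shows "(\<integral>\<^sup>+s. ennreal (indicator {0<..} s * s powr (- (1/2)) * (1 - exp (- a / s))) \<partial>lborel)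
           = ennreal (2 * sqrt pi * sqrt a)"
proof (cases "a = 0")
  case False
  with a have a: "a > 0" by simp
  have cake: "(\<integral>\<^sup>+w. ennreal (exp (-w)) * indicator {0..b} w \<partial>lborel) = ennreal (1 - exp (-b))"
    if "b \<ge> 0" for b :: real
    by (subst nn_integral_FTC_Icc[where F = "\<lambda>w. - exp (-w)"])
      (use that in \<open>auto intro!: derivative_eq_intros\<close>)
  have root: "(\<integral>\<^sup>+s. ennreal (indicator {0<..b} s * s powr (- (1/2))) \<partial>lborel) = ennreal (2 * sqrt b)"
    if "b > 0" for b :: real
  proof -
    have "((\<lambda>s. s powr (- (1/2))) has_integral (b powr (-1/2+1) / (-1/2+1))) {0..b}"
      using has_integral_powr_from_0[of "-1/2" b] that by simp
    from nn_integral_has_integral_lebesgue[OF _ this]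
    have "(\<integral>\<^sup>+s. ennreal (indicator {0..b} s * s powr (- (1/2))) \<partial>lborel) = ennreal (2 * sqrt b)"
      using that by (simp add: powr_half_sqrt)
    moreover have "(\<integral>\<^sup>+s. ennreal (indicator {0<..b} s * s powr (- (1/2))) \<partial>lborel)
        = (\<integral>\<^sup>+s. ennreal (indicator {0..b} s * s powr (- (1/2))) \<partial>lborel)"
      by (intro nn_integral_cong) (auto simp: indicator_def)
    ultimately show ?thesis by simp
  qed
  let ?h = "\<lambda>s w. ennreal (if 0 < s \<and> 0 < w \<and> s * w \<le> a then s powr (- (1/2)) * exp (-w) else 0)"
  have "(\<integral>\<^sup>+s. ennreal (indicator {0<..} s * s powr (- (1/2)) * (1 - exp (- a / s))) \<partial>lborel)
          = (\<integral>\<^sup>+s. (\<integral>\<^sup>+w. ?h s w \<partial>lborel) \<partial>lborel)"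
  proof (intro nn_integral_cong)
    fix s :: real
    show "ennreal (indicator {0<..} s * s powr (- (1/2)) * (1 - exp (- a / s))) = (\<integral>\<^sup>+w. ?h s w \<partial>lborel)"
    proof (cases "s > 0")
      case True
      have "(\<integral>\<^sup>+w. ?h s w \<partial>lborel)
          = (\<integral>\<^sup>+w. ennreal (s powr (- (1/2))) * (ennreal (exp (-w)) * indicator {0..a/s} w) \<partial>lborel)"
      proof (rule nn_integral_cong_AE)
        \<comment> \<open>The kernel is set to zero at \<open>w = 0\<close>; this differs from the integrand on a null set only.\<close>
        have "AE w in lborel. w \<noteq> (0::real)" by (rule AE_lborel_singleton)
        then show "AE w in lborel. ?h s w
           = ennreal (s powr (- (1/2))) * (ennreal (exp (-w)) * indicator {0..a/s} w)"
          by eventually_elim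
            (use True in \<open>auto simp: indicator_def field_simps simp flip: ennreal_mult\<close>)
      qed
      also have "\<dots> = ennreal (s powr (- (1/2))) * ennreal (1 - exp (-(a/s)))"
        using True a by (subst nn_integral_cmult) (auto simp: cake)
      finally show ?thesis
        using True a by (simp flip: ennreal_mult)
    qed simp
  qed
  also have "\<dots> = (\<integral>\<^sup>+w. (\<integral>\<^sup>+s. ?h s w \<partial>lborel) \<partial>lborel)"
    by (rule lborel_pair.Fubini') measurable
  also have "\<dots> = (\<integral>\<^sup>+w. ennreal (2 * sqrt a) *
       ennreal (indicator {0..} w * w powr (1/2 - 1) * exp (- 1 * w)) \<partial>lborel)"
  proof (intro nn_integral_cong)
    fix w :: real
    show "(\<integral>\<^sup>+s. ?h s w \<partial>lborel)
        = ennreal (2 * sqrt a) * ennreal (indicator {0..} w * w powr (1/2 - 1) * exp (- 1 * w))"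
    proof (cases "w > 0")
      case True
      have "(\<integral>\<^sup>+s. ?h s w \<partial>lborel)
          = (\<integral>\<^sup>+s. ennreal (exp (-w)) * ennreal (indicator {0<..a/w} s * s powr (- (1/2))) \<partial>lborel)"
        using True
        by (intro nn_integral_cong) (auto simp: indicator_def field_simps simp flip: ennreal_mult)
      also have "\<dots> = ennreal (exp (-w)) * ennreal (2 * sqrt (a/w))"
        using True a by (subst nn_integral_cmult) (auto simp: root)
      finally show ?thesis
        using True a
        by (simp add: real_sqrt_divide powr_minus powr_half_sqrt field_simps flip: ennreal_mult)
    qed (auto simp: indicator_def)
  qed
  also have "\<dots> = ennreal (2 * sqrt a) * ennreal (Gamma (1/2) / 1 powr (1/2))"
    by (subst nn_integral_cmult) (simp_all only: nn_integral_gamma_kernel, auto)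
  finally show ?thesis
    using a by (simp add: Gamma_one_half_real mult_ac flip: ennreal_mult)
qed simp

section \<open>The Fourier transform of a Gaussian\<close>

text \<open>
  The characteristic function of the standard normal distribution, rescaled by
  \<open>u \<mapsto> sqrt (2 * s) * u\<close>.
\<close>
lemma gaussian_fourier_1d:
  fixes s y :: real
  assumes s: "s > 0"
  shows "has_bochner_integral lborel (\<lambda>u. of_real (exp (- s * u\<^sup>2)) * cis (u * y))
           (of_real (sqrt (pi / s) * exp (- y\<^sup>2 / (4 * s))))"
proof -
  define c where "c = sqrt (2 * s)"
  have c: "c > 0" "c\<^sup>2 = 2 * s" using s by (auto simp: c_def)
  interpret real_distribution std_normal_distribution by (rule real_dist_normal_dist)
  have std: "has_bochner_integral lborel (\<lambda>x. std_normal_density x *\<^sub>R cis (v * x))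
      (of_real (exp (- v\<^sup>2 / 2)))" for v
  proof -
    have [measurable]: "(\<lambda>x. cis (v * x)) \<in> borel_measurable borel"
      by (intro borel_measurable_continuous_onI continuous_intros)
    have 1: "integrable std_normal_distribution (\<lambda>x. cis (v * x))"
      by (rule integrable_const_bound[where B = 1]) auto
    have "integral\<^sup>L std_normal_distribution (\<lambda>x. cis (v * x)) = of_real (exp (- v\<^sup>2 / 2))"
      using fun_cong[OF char_std_normal_distribution, of v] by (simp add: char_def cis_conv_exp)
    with 1 show ?thesis
      by (auto simp: has_bochner_integral_iff integrable_density integral_density)
  qed
  have "has_bochner_integral lborel (\<lambda>u. std_normal_density (0 + c * u) *\<^sub>R cis (y / c * (0 + c * u)))
          (of_real (exp (- (y / c)\<^sup>2 / 2)) /\<^sub>R \<bar>c\<bar>)"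
    using c lborel_has_bochner_integral_real_affine_iff[where c = c and t = 0,
        THEN iffD1, OF _ std[of "y / c"]] by simp
  from has_bochner_integral_mult_right[OF this, of "of_real (sqrt (2 * pi))"]
  have *: "has_bochner_integral lborel
      (\<lambda>u. of_real (sqrt (2 * pi)) * (std_normal_density (0 + c * u) *\<^sub>R cis (y / c * (0 + c * u))))
          (of_real (sqrt (2 * pi)) * (of_real (exp (- (y / c)\<^sup>2 / 2)) /\<^sub>R \<bar>c\<bar>))" by simp
  have 1: "of_real (sqrt (2 * pi)) * (std_normal_density (0 + c * u) *\<^sub>R cis (y / c * (0 + c * u)))
      = of_real (exp (- s * u\<^sup>2)) * cis (u * y)" for u
    using c by (simp add: std_normal_density_def scaleR_conv_of_real power_mult_distrib mult.commute)
  have "sqrt (2 * pi) / c = sqrt (pi / s)"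
    using s by (simp add: c_def real_sqrt_mult real_sqrt_divide)
  moreover have "- (y / c)\<^sup>2 / 2 = - y\<^sup>2 / (4 * s)"
    by (simp add: power_divide c)
  ultimately have 2: "of_real (sqrt (2 * pi)) * (of_real (exp (- (y / c)\<^sup>2 / 2)) /\<^sub>R \<bar>c\<bar>)
      = complex_of_real (sqrt (pi / s) * exp (- y\<^sup>2 / (4 * s)))"
    using c by (simp add: scaleR_conv_of_real divide_simps mult_ac flip: of_real_mult of_real_divide)
  show ?thesis using * unfolding 1 2 .
qed

lemma has_bochner_integral_lborel_prod:
  fixes f :: "'a::euclidean_space \<Rightarrow> real \<Rightarrow> 'c::{real_normed_field,banach,second_countable_topology}"
  assumes f: "\<And>b. b \<in> Basis \<Longrightarrow> has_bochner_integral lborel (f b) (I b)"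
  shows "has_bochner_integral lborel (\<lambda>x. \<Prod>b\<in>Basis. f b (x \<bullet> b)) (\<Prod>b\<in>Basis. I b)"
proof -
  interpret product_sigma_finite "\<lambda>_::'a. lborel :: real measure" ..
  have [measurable]: "f b \<in> borel_measurable borel" if "b \<in> Basis" for b
    using borel_measurable_has_bochner_integral[OF f[OF that]] by simp
  have int: "integrable lborel (f b)" "integral\<^sup>L lborel (f b) = I b" if "b \<in> Basis" for b
    using f[OF that] by (auto simp: has_bochner_integral_iff)
  have "has_bochner_integral (\<Pi>\<^sub>M b\<in>Basis. lborel) (\<lambda>x. \<Prod>b\<in>Basis. f b (x b)) (\<Prod>b\<in>Basis. I b)"
    using int by (simp add: has_bochner_integral_iff product_integrable_prod product_integral_prod)
  then show ?thesis
    by (subst lborel_eq)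
          (simp add: has_bochner_integral_iff integrable_distr_eq integral_distr cong: prod.cong)
qed

text \<open>
  Both \<open>exp (- s * (norm t)\<^sup>2)\<close> and \<open>cis (t \<bullet> x)\<close> factor over an orthonormal basis, so the
  transform is a product of one-dimensional ones.
\<close>
lemma gaussian_fourier:
  fixes x :: "'a::euclidean_space"
  assumes s: "s > 0"
  shows "has_bochner_integral lborel (\<lambda>t. of_real (exp (- s * (norm t)\<^sup>2)) * cis (t \<bullet> x))
           (of_real ((pi / s) powr (real DIM('a) / 2) * exp (- (norm x)\<^sup>2 / (4 * s))))"
proof -
  have ns: "(norm v)\<^sup>2 = (\<Sum>b\<in>Basis. (v \<bullet> b)\<^sup>2)" for v :: 'a
    unfolding power2_norm_eq_inner by (subst euclidean_inner) (simp add: power2_eq_square)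
  have cis_sum: "cis (\<Sum>b\<in>B. g b) = (\<Prod>b\<in>B. cis (g b))" if "finite B" for g and B :: "'a set"
    using that by (induction B) (auto simp: cis_mult[symmetric])
  have 1: "(\<Prod>b\<in>Basis. of_real (exp (- s * (t \<bullet> b)\<^sup>2)) * cis ((t \<bullet> b) * (x \<bullet> b)))
     = of_real (exp (- s * (norm t)\<^sup>2)) * cis (t \<bullet> x)" for t
    by (simp add: prod.distrib ns euclidean_inner[of t x] cis_sum sum_distrib_left exp_sum
        sum_negf[symmetric] flip: of_real_prod)
  have 2: "(\<Prod>b\<in>(Basis::'a set). sqrt (pi / s) * exp (- (x \<bullet> b)\<^sup>2 / (4 * s)))
     = (pi / s) powr (real DIM('a) / 2) * exp (- (norm x)\<^sup>2 / (4 * s))"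
  proof -
    have "(\<Prod>b\<in>(Basis::'a set). exp (- (x \<bullet> b)\<^sup>2 / (4 * s))) = exp (- (norm x)\<^sup>2 / (4 * s))"
      by (simp add: ns exp_sum[symmetric] sum_divide_distrib[symmetric] sum_negf)
    moreover have "sqrt (pi / s) ^ DIM('a) = (pi / s) powr (real DIM('a) / 2)"
      using s by (simp add: powr_half_sqrt[symmetric] powr_power)
    ultimately show ?thesis by (simp add: prod.distrib)
  qed
  show ?thesis
    using has_bochner_integral_lborel_prod[where
        f = "\<lambda>b u. of_real (exp (- s * u\<^sup>2)) * cis (u * (x \<bullet> b))", OF gaussian_fourier_1d[OF s]]
    unfolding 1 of_real_prod[symmetric] 2 .
qed

section \<open>The norm as a weighted integral of one minus cosine\<close>

lemma nn_integral_one_minus_cos_gaussian: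
  fixes x :: "'a::euclidean_space"
  assumes s: "s > 0"
  shows "(\<integral>\<^sup>+t. ennreal (exp (- s * (norm t)\<^sup>2) * (1 - cos (t \<bullet> x))) \<partial>lborel)
           = ennreal ((pi / s) powr (real DIM('a) / 2) * (1 - exp (- (norm x)\<^sup>2 / (4 * s))))"
proof -
  have re: "has_bochner_integral lborel (\<lambda>t. exp (- s * (norm t)\<^sup>2) * cos (t \<bullet> v))
      ((pi / s) powr (real DIM('a) / 2) * exp (- (norm v)\<^sup>2 / (4 * s)))" for v :: 'a
    using has_bochner_integral_bounded_linear[OF bounded_linear_Re gaussian_fourier[OF s, of v]]
    by simp
  have "has_bochner_integral lborel (\<lambda>t. exp (- s * (norm t)\<^sup>2) * (1 - cos (t \<bullet> x)))
      ((pi / s) powr (real DIM('a) / 2) * (1 - exp (- (norm x)\<^sup>2 / (4 * s))))"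
    using has_bochner_integral_diff[OF re[of 0] re[of x]] by (simp add: algebra_simps)
  then show ?thesis
    by (subst nn_integral_eq_integral) (auto simp: has_bochner_integral_iff)
qed

text \<open>
  The one-variable factor of the weight in \<open>weighted_norm_sq\<close>. At the origin it is \<open>0\<close> by
  \<open>x / 0 = 0\<close>.
\<close>
definition dcov_weight :: "'a::euclidean_space \<Rightarrow> real" where
  "dcov_weight t = 1 / (dcov_const DIM('a) * norm t ^ (1 + DIM('a)))"

lemma dcov_const_pos: "dcov_const d > 0"
  by (simp add: dcov_const_def Gamma_real_pos add_pos_nonneg)

lemma dcov_weight_nonneg: "dcov_weight (t :: 'a::euclidean_space) \<ge> 0"
  using dcov_const_pos[of "DIM('a)"] by (simp add: dcov_weight_def less_imp_le)

lemma dcov_weight_measurable [measurable]: "dcov_weight \<in> borel_measurable borel"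
  unfolding dcov_weight_def by measurable

text \<open>
  Replace \<open>1 / norm t ^ (1 + d)\<close> by its mixture of Gaussians and exchange the integrals. The inner
  integral over \<open>t\<close> becomes a constant times
  \<open>(1 - exp (- (norm x)\<^sup>2 / (4 * s))) / s powr (d / 2)\<close>. The mixing density has the factor
  \<open>s powr ((d - 1) / 2)\<close>, so the power of \<open>s\<close> that remains is \<open>s powr (- 1/2)\<close> in every dimension,
  and the integral over \<open>s\<close> is proportional to \<open>norm x\<close>.
  The constant \<open>dcov_const d\<close> is what normalizes the factor to \<open>1\<close>.
\<close>
lemma nn_integral_one_minus_cos_over_norm_power:
  fixes x :: "'a::euclidean_space"
  shows "(\<integral>\<^sup>+t. ennreal (dcov_weight t * (1 - cos (t \<bullet> x))) \<partial>lborel)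
           = ennreal (norm x)"
proof -
  define d where "d = real DIM('a)"
  define z where "z = (1 + d) / 2"
  have z: "z > 0" by (simp add: z_def d_def)
  have G: "Gamma z > 0" using z by (rule Gamma_real_pos)
  have dc: "dcov_const DIM('a) = pi powr z / Gamma z"
    by (simp add: dcov_const_def z_def d_def)
  let ?h = "\<lambda>(t::'a) s. ennreal (indicator {0<..} s * (s powr (z - 1) / pi powr z)
      * (exp (- s * (norm t)\<^sup>2) * (1 - cos (t \<bullet> x))))"
  have "(\<integral>\<^sup>+t. ennreal (dcov_weight t * (1 - cos (t \<bullet> x))) \<partial>lborel)
      = (\<integral>\<^sup>+t. (\<integral>\<^sup>+s. ?h t s \<partial>lborel) \<partial>lborel)"
  proof (rule nn_integral_cong)
    fix t :: 'a
    show "ennreal (dcov_weight t * (1 - cos (t \<bullet> x)))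
        = (\<integral>\<^sup>+s. ?h t s \<partial>lborel)"
    proof (cases "t = 0")
      case False
      have "((norm t)\<^sup>2) powr z = norm t powr (2 * z)"
        using False by (simp add: powr_powr flip: powr_numeral)
      also have "\<dots> = norm t ^ (1 + DIM('a))"
        using False by (subst powr_realpow[symmetric]) (simp_all add: z_def d_def add_divide_distrib)
      finally have p: "((norm t)\<^sup>2) powr z = norm t ^ (1 + DIM('a))" .
      have "(\<integral>\<^sup>+s. ?h t s \<partial>lborel) = (\<integral>\<^sup>+s. ennreal ((1 - cos (t \<bullet> x)) / pi powr z) *
          ennreal (indicator {0..} s * s powr (z - 1) * exp (- ((norm t)\<^sup>2) * s)) \<partial>lborel)"
        by (intro nn_integral_cong)
           (auto simp: indicator_def mult_ac simp flip: ennreal_mult)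
      also have "\<dots> = ennreal ((1 - cos (t \<bullet> x)) / pi powr z) * ennreal (Gamma z / ((norm t)\<^sup>2) powr z)"
        using False by (subst nn_integral_gamma_kernel[OF z, symmetric])
          (simp, rule nn_integral_cmult, simp)
      also have "\<dots> = ennreal (dcov_weight t * (1 - cos (t \<bullet> x)))"
        unfolding p dc dcov_weight_def using G by (subst ennreal_mult[symmetric])
          (simp_all add: field_simps)
      finally show ?thesis by simp
    qed (simp add: dcov_weight_def)
  qed
  also have "\<dots> = (\<integral>\<^sup>+s. (\<integral>\<^sup>+t. ?h t s \<partial>lborel) \<partial>lborel)"
    by (rule lborel_pair.Fubini'[symmetric]) measurable
  also have "\<dots> = (\<integral>\<^sup>+s. ennreal (1 / sqrt pi) *
      ennreal (indicator {0<..} s * s powr (- (1/2)) * (1 - exp (- ((norm x)\<^sup>2 / 4) / s))) \<partial>lborel)"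
  proof (rule nn_integral_cong)
    fix s :: real
    show "(\<integral>\<^sup>+t. ?h t s \<partial>lborel) = ennreal (1 / sqrt pi) *
      ennreal (indicator {0<..} s * s powr (- (1/2)) * (1 - exp (- ((norm x)\<^sup>2 / 4) / s)))"
    proof (cases "s > 0")
      case True
      have "(\<integral>\<^sup>+t. ?h t s \<partial>lborel) = (\<integral>\<^sup>+t. ennreal (s powr (z - 1) / pi powr z) *
          ennreal (exp (- s * (norm t)\<^sup>2) * (1 - cos (t \<bullet> x))) \<partial>lborel)"
        using True by (intro nn_integral_cong) (simp flip: ennreal_mult)
      also have "\<dots> = ennreal (s powr (z - 1) / pi powr z) *
          ennreal ((pi / s) powr (d / 2) * (1 - exp (- (norm x)\<^sup>2 / (4 * s))))"
        by (subst nn_integral_cmult) (simp_all only: nn_integral_one_minus_cos_gaussian[OF True] d_def, auto)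
      also have "\<dots> = ennreal (s powr (z - 1) / pi powr z *
          ((pi / s) powr (d / 2) * (1 - exp (- (norm x)\<^sup>2 / (4 * s)))))"
        using True by (intro ennreal_mult[symmetric]) auto
      also have "s powr (z - 1) / pi powr z * ((pi / s) powr (d / 2) * (1 - exp (- (norm x)\<^sup>2 / (4 * s))))
         = 1 / sqrt pi * (s powr (- (1/2)) * (1 - exp (- ((norm x)\<^sup>2 / 4) / s)))"
      proof -
        have "s powr (z - 1) / pi powr z * (pi / s) powr (d / 2)
            = (s powr (z - 1) / s powr (d / 2)) * (pi powr (d / 2) / pi powr z)"
          using True by (simp add: powr_divide)
        also have "\<dots> = s powr (- (1/2)) * pi powr (- (1/2))"
          by (simp add: powr_diff[symmetric] z_def field_simps)
        finally show ?thesis using True by (simp add: powr_minus powr_half_sqrt field_simps)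
      qed
      also have "ennreal \<dots> = ennreal (1 / sqrt pi) *
          ennreal (s powr (- (1/2)) * (1 - exp (- ((norm x)\<^sup>2 / 4) / s)))"
        using True by (intro ennreal_mult) auto
      finally show ?thesis using True by simp
    qed simp
  qed
  also have "\<dots> = ennreal (1 / sqrt pi) * ennreal (2 * sqrt pi * sqrt ((norm x)\<^sup>2 / 4))"
    by (subst nn_integral_one_minus_exp_inverse[symmetric]) (simp, rule nn_integral_cmult, simp)
  also have "\<dots> = ennreal (norm x)"
    by (simp add: real_sqrt_divide flip: ennreal_mult)
  finally show ?thesis .
qed

lemma has_bochner_integral_one_minus_cos:
  fixes x :: "'a::euclidean_space"
  shows "has_bochner_integral lborel (\<lambda>t. dcov_weight t * (1 - cos (t \<bullet> x))) (norm x)"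
  by (rule has_bochner_integral_nn_integral)
     (simp_all add: dcov_weight_nonneg nn_integral_one_minus_cos_over_norm_power)

section \<open>Reflections and products for Lebesgue measure\<close>

lemma has_bochner_integral_lborel_reflect:
  fixes f :: "'a::euclidean_space \<Rightarrow> 'b::{banach,second_countable_topology}"
  assumes "has_bochner_integral lborel f I"
  shows "has_bochner_integral lborel (\<lambda>t. f (- t)) I"
proof -
  have eq: "(lborel :: 'a measure) = distr lborel borel uminus"
    using lborel_affine[of "-1" "0::'a"] by (simp add: density_1)
  have [measurable]: "f \<in> borel_measurable borel"
    using borel_measurable_has_bochner_integral[OF assms] by simp
  have "has_bochner_integral (distr lborel borel uminus) f I"
    by (subst eq[symmetric]) (rule assms)
  then show ?thesis
    by (simp add: has_bochner_integral_iff integrable_distr_eq integral_distr)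
qed

lemma has_bochner_integral_lborel_times:
  fixes f :: "'a::euclidean_space \<Rightarrow> 'c::{real_normed_field,banach,second_countable_topology}"
    and g :: "'b::euclidean_space \<Rightarrow> 'c"
  assumes f: "has_bochner_integral lborel f I" and g: "has_bochner_integral lborel g J"
  shows "has_bochner_integral lborel (\<lambda>(t, s). f t * g s) (I * J)"
proof -
  have [measurable]: "f \<in> borel_measurable borel" "g \<in> borel_measurable borel"
    using borel_measurable_has_bochner_integral[OF f] borel_measurable_has_bochner_integral[OF g]
    by auto
  have fi: "integrable lborel f" "integral\<^sup>L lborel f = I"
    and gi: "integrable lborel g" "integral\<^sup>L lborel g = J"
    using f g by (auto simp: has_bochner_integral_iff)
  have int: "integrable (lborel \<Otimes>\<^sub>M lborel) (\<lambda>(t, s). f t * g s)"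
    by (rule lborel_pair.Fubini_integrable) (use fi gi in \<open>auto simp: norm_mult\<close>)
  moreover have "integral\<^sup>L (lborel \<Otimes>\<^sub>M lborel) (\<lambda>(t, s). f t * g s) = I * J"
    using lborel_pair.integral_fst'[OF int] fi gi by simp
  ultimately show ?thesis
    by (simp add: has_bochner_integral_iff lborel_prod)
qed

section \<open>Double centering\<close>

lemma has_bochner_integral_double_centered:
  assumes "\<And>k l. has_bochner_integral M (\<lambda>t. h t k l) (I k l)"
  shows "has_bochner_integral M (\<lambda>t. double_centered n (h t) k l) (double_centered n I k l)"
  unfolding double_centered_def mean_row_def mean_col_def mean_all_def
  by (intro has_bochner_integral_add has_bochner_integral_diff has_bochner_integral_mult_right
      has_bochner_integral_sum assms)

lemma double_centered_scale:
  "double_centered n (\<lambda>k l. c * f k l) k l = c * double_centered n f k l"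
  by (simp add: double_centered_def mean_row_def mean_col_def mean_all_def
      sum_distrib_left[symmetric] algebra_simps)

lemma double_centered_const_minus:
  assumes "n > 0"
  shows "double_centered n (\<lambda>k l. c - f k l) k l = - double_centered n f k l"
  using assms
  by (simp add: double_centered_def mean_row_def mean_col_def mean_all_def sum_subtractf
      power2_eq_square field_simps)

text \<open>
  Centering a complex sample before forming the products \<open>u k * cnj (u l)\<close> has the same effect as
  double centering the matrix of products afterwards: row, column and total means of that matrix are
  \<open>u k * cnj m\<close>, \<open>m * cnj (u l)\<close> and \<open>m * cnj m\<close>.
\<close>
lemma double_centered_Re_cnj:
  fixes u :: "nat \<Rightarrow> complex" and n :: nat
  defines "m \<equiv> (1 / of_nat n) * (\<Sum>j=1..n. u j)"
  shows "double_centered n (\<lambda>k l. Re (u k * cnj (u l))) k l = Re ((u k - m) * cnj (u l - m))"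
proof -
  have row: "mean_row n (\<lambda>k l. Re (u k * cnj (u l))) k = Re (u k * cnj m)"
    by (simp add: mean_row_def m_def sum_distrib_left sum.distrib
        Re_divide_of_nat Im_divide_of_nat sum_divide_distrib add_divide_distrib)
  have col: "mean_col n (\<lambda>k l. Re (u k * cnj (u l))) l = Re (m * cnj (u l))"
    by (simp add: mean_col_def m_def sum_distrib_right sum.distrib
        Re_divide_of_nat Im_divide_of_nat sum_divide_distrib add_divide_distrib)
  have "mean_all n (\<lambda>k l. Re (u k * cnj (u l)))
      = Re (((1 / of_nat n) * (1 / of_nat n))
          * ((\<Sum>k=1..n. u k) * cnj (\<Sum>l=1..n. u l)))"
    unfolding cnj_sum sum_product
    by (simp add: mean_all_def power2_eq_square flip: of_nat_mult)
  then have all: "mean_all n (\<lambda>k l. Re (u k * cnj (u l))) = Re (m * cnj m)"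
    by (simp add: m_def mult_ac)
  show ?thesis
    unfolding double_centered_def row col all by (simp add: algebra_simps)
qed

section \<open>Centered characters of a sample\<close>

definition centered_character :: "nat \<Rightarrow> (nat \<Rightarrow> real ^ 'd) \<Rightarrow> nat \<Rightarrow> real ^ 'd \<Rightarrow> complex" where
  "centered_character n x k t = cis (t \<bullet> x k) - ecf n x t"

lemma ecf_eq_cis: "ecf n x t = (1 / of_nat n) * (\<Sum>k=1..n. cis (t \<bullet> x k))"
  by (simp add: ecf_def cis_conv_exp)

lemma centered_character_measurable [measurable]:
  "centered_character n x k \<in> borel_measurable borel"
  unfolding centered_character_def ecf_def
  by (intro borel_measurable_continuous_onI continuous_intros)

text \<open>
  The cosine is traded for \<open>1 - cos\<close>, because \<open>1 - cos\<close> is integrable against the weight and the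
  cosine is not; double centering kills the constant.
\<close>
lemma Re_centered_character:
  assumes "n > 0"
  shows "Re (centered_character n x k t * cnj (centered_character n x l t))
     = - double_centered n (\<lambda>k l. 1 - cos (t \<bullet> (x k - x l))) k l"
proof -
  have "Re (cis (t \<bullet> x k) * cnj (cis (t \<bullet> x l))) = cos (t \<bullet> (x k - x l))" for k l
    by (simp add: cos_diff inner_diff_right)
  then show ?thesis
    using double_centered_Re_cnj[of n "\<lambda>k. cis (t \<bullet> x k)" k l] assms
    by (simp add: double_centered_const_minus centered_character_def ecf_eq_cis)
qed

lemma centered_character_uminus:
  "centered_character n x k (- t) = cnj (centered_character n x k t)"
  by (simp add: centered_character_def ecf_eq_cis cis_cnj)

lemma Re_of_real_times: "Re (of_real r * w) = r * Re w"
  by simp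

text \<open>
  The real part is a double centering of functions \<open>1 - cos\<close>, whose integrals are distances. The
  imaginary part is a double centering of sines, and a single nonzero sine is not absolutely
  integrable against the weight near the origin, so it cannot be treated termwise. The whole product is
  integrable because it is dominated by the two squares \<open>(cmod (z k t))\<^sup>2\<close> and
  \<open>(cmod (z l t))\<^sup>2\<close>, which are diagonal cases of the real part. Since \<open>t \<mapsto> - t\<close> conjugates the
  integrand, its integral is real.
\<close>
lemma has_bochner_integral_centered_characters:
  assumes n: "n > 0"
  shows "has_bochner_integral lborel
    (\<lambda>t. of_real (dcov_weight t) * (centered_character n x k t * cnj (centered_character n x l t)))
    (- of_real (double_centered n (pair_dist x) k l))"
proof -
  let ?z = "centered_character n x"
  have re: "has_bochner_integral lborel (\<lambda>t. dcov_weight t * Re (?z k t * cnj (?z l t)))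
      (- double_centered n (pair_dist x) k l)" for k l
  proof -
    have "has_bochner_integral lborel
      (\<lambda>t. double_centered n (\<lambda>k l. dcov_weight t * (1 - cos (t \<bullet> (x k - x l)))) k l)
      (double_centered n (pair_dist x) k l)"
      unfolding pair_dist_def
      by (intro has_bochner_integral_double_centered has_bochner_integral_one_minus_cos)
    from has_bochner_integral_minus[OF this] show ?thesis
      by (simp only: double_centered_scale Re_centered_character[OF n] mult_minus_right)
  qed
  have sq: "integrable lborel (\<lambda>t. dcov_weight t * (cmod (?z k t))\<^sup>2)" for k
    using re[of k k] by (simp add: has_bochner_integral_iff complex_mult_cnj cmod_power2)
  let ?P = "\<lambda>t. of_real (dcov_weight t) * (?z k t * cnj (?z l t))"
  have "cnj \<in> borel_measurable borel"
    by (intro borel_measurable_continuous_onI continuous_intros)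
  then have [measurable]: "(\<lambda>t. cnj (?z l t)) \<in> borel_measurable borel"
    by (rule measurable_compose[OF centered_character_measurable])
  have [measurable]: "?P \<in> borel_measurable lborel" by measurable
  have "integrable lborel ?P"
  proof (rule Bochner_Integration.integrable_bound)
    show "integrable lborel (\<lambda>t. dcov_weight t * (cmod (?z k t))\<^sup>2 + dcov_weight t * (cmod (?z l t))\<^sup>2)"
      by (intro Bochner_Integration.integrable_add sq)
    show "AE t in lborel. norm (?P t)
        \<le> norm (dcov_weight t * (cmod (?z k t))\<^sup>2 + dcov_weight t * (cmod (?z l t))\<^sup>2)"
    proof (rule AE_I2)
      fix t :: "real ^ 'a"
      have "2 * (cmod (?z k t) * cmod (?z l t)) \<le> (cmod (?z k t))\<^sup>2 + (cmod (?z l t))\<^sup>2"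
        using sum_squares_bound[of "cmod (?z k t)" "cmod (?z l t)"] by simp
      moreover have "0 \<le> cmod (?z k t) * cmod (?z l t)" by simp
      ultimately have "cmod (?z k t) * cmod (?z l t) \<le> (cmod (?z k t))\<^sup>2 + (cmod (?z l t))\<^sup>2"
        by linarith
      from mult_left_mono[OF this dcov_weight_nonneg[of t]]
      show "norm (?P t) \<le> norm (dcov_weight t * (cmod (?z k t))\<^sup>2 + dcov_weight t * (cmod (?z l t))\<^sup>2)"
        by (simp add: norm_mult dcov_weight_nonneg algebra_simps)
    qed
  qed measurable
  then obtain J where J: "has_bochner_integral lborel ?P J"
    by (auto simp: integrable.simps)
  have "has_bochner_integral lborel (\<lambda>t. cnj (?P (- t))) (cnj J)"
    by (rule has_bochner_integral_bounded_linear[OF bounded_linear_cnj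
          has_bochner_integral_lborel_reflect[OF J]])
  moreover have "cnj (?P (- t)) = ?P t" for t
    by (simp add: centered_character_uminus dcov_weight_def)
  ultimately have "cnj J = J" using J by (simp add: has_bochner_integral_eq)
  moreover have "Re J = - double_centered n (pair_dist x) k l"
    using has_bochner_integral_bounded_linear[OF bounded_linear_Re J] re[of k l]
    unfolding Re_of_real_times by (rule has_bochner_integral_eq)
  ultimately have "J = - of_real (double_centered n (pair_dist x) k l)"
    by (simp add: complex_eq_iff)
  with J show ?thesis by simp
qed

section \<open>The distance covariance of a sample\<close>

text \<open>
  Characters multiply, so the joint characteristic function is the mean of the products
  \<open>cis (t \<bullet> x k) * cis (s \<bullet> y k)\<close>, and the usual identity for covariances applies.
\<close>
lemma joint_ecf_minus_product:
  assumes "n > 0"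
  shows "joint_ecf n x y t s - ecf n x t * ecf n y s
    = (1 / of_nat n) * (\<Sum>k=1..n. centered_character n x k t * centered_character n y k s)"
proof -
  let ?u = "\<lambda>k. cis (t \<bullet> x k)" and ?v = "\<lambda>k. cis (s \<bullet> y k)"
  have e: "(\<Sum>k=1..n. ?u k) = of_nat n * ecf n x t" "(\<Sum>k=1..n. ?v k) = of_nat n * ecf n y s"
    using assms by (simp_all add: ecf_eq_cis)
  have "(\<Sum>k=1..n. centered_character n x k t * centered_character n y k s)
     = (\<Sum>k=1..n. ?u k * ?v k) - (\<Sum>k=1..n. ?u k) * ecf n y s - ecf n x t * (\<Sum>k=1..n. ?v k)
         + of_nat n * (ecf n x t * ecf n y s)"
    by (simp add: centered_character_def algebra_simps sum.distrib sum_subtractf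
        sum_distrib_left sum_distrib_right)
  also have "\<dots> = (\<Sum>k=1..n. ?u k * ?v k) - of_nat n * (ecf n x t * ecf n y s)"
    unfolding e by simp
  finally show ?thesis
    using assms by (simp add: joint_ecf_def cis_conv_exp exp_add right_diff_distrib)
qed

lemma cmod_sq_mean_of_products:
  fixes p q :: "nat \<Rightarrow> complex"
  shows "(cmod ((1 / of_nat n) * (\<Sum>k=1..n. p k * q k)))\<^sup>2
     = (1 / (real n)\<^sup>2) * (\<Sum>k=1..n. \<Sum>l=1..n. Re ((p k * cnj (p l)) * (q k * cnj (q l))))"
proof -
  have "(cmod w)\<^sup>2 = Re (w * cnj w)" for w
    by (simp add: complex_mult_cnj cmod_power2)
  then have "(cmod (\<Sum>k=1..n. p k * q k))\<^sup>2 = (\<Sum>k=1..n. \<Sum>l=1..n. Re ((p k * q k) * cnj (p l * q l)))"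
    by (simp only: cnj_sum sum_product Re_sum)
  moreover have "(p k * q k) * cnj (p l * q l) = (p k * cnj (p l)) * (q k * cnj (q l))" for k l
    by (simp add: mult_ac)
  ultimately have "(\<Sum>k=1..n. \<Sum>l=1..n. Re ((p k * cnj (p l)) * (q k * cnj (q l))))
      = (cmod (\<Sum>k=1..n. p k * q k))\<^sup>2"
    by (simp only:)
  then show ?thesis
    by (simp only:) (simp add: norm_mult norm_divide power_mult_distrib power_divide)
qed

text \<open>
  Integrating the expansion of the squared modulus term by term, each double integral factors and
  the two minus signs of the centered distances cancel.
\<close>
lemma weighted_norm_sq_eq_dcov_sq:
  fixes x :: "nat \<Rightarrow> real ^ 'p" and y :: "nat \<Rightarrow> real ^ 'q"
  assumes n: "n > 0"
  shows "ereal (dcov_sq n x y)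
    = enn2ereal (weighted_norm_sq (\<lambda>t s. joint_ecf n x y t s - ecf n x t * ecf n y s))"
proof -
  let ?F = "\<lambda>(t, s). (cmod (joint_ecf n x y t s - ecf n x t * ecf n y s))\<^sup>2 /
        (dcov_const CARD('p) * dcov_const CARD('q) *
         norm t ^ (1 + CARD('p)) * norm s ^ (1 + CARD('q)))"
  define U where "U k l t = centered_character n x k t * cnj (centered_character n x l t)" for k l t
  define V where "V k l s = centered_character n y k s * cnj (centered_character n y l s)" for k l s
  define P where "P k l t = of_real (dcov_weight t) * U k l t" for k l t
  define Q where "Q k l s = of_real (dcov_weight s) * V k l s" for k l s
  have P: "has_bochner_integral lborel (P k l) (- of_real (double_centered n (pair_dist x) k l))"
    and Q: "has_bochner_integral lborel (Q k l) (- of_real (double_centered n (pair_dist y) k l))"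
    for k l
    unfolding P_def Q_def U_def V_def by (intro has_bochner_integral_centered_characters n)+
  have F: "?F = (\<lambda>(t, s). (1 / (real n)\<^sup>2) * (\<Sum>k=1..n. \<Sum>l=1..n. Re (P k l t * Q k l s)))"
  proof (rule ext)
    fix z :: "(real ^ 'p) \<times> (real ^ 'q)"
    obtain t s where z: "z = (t, s)" by force
    have PQ: "Re (P k l t * Q k l s) = dcov_weight t * dcov_weight s * Re (U k l t * V k l s)" for k l
    proof -
      have "P k l t * Q k l s = of_real (dcov_weight t * dcov_weight s) * (U k l t * V k l s)"
        by (simp add: P_def Q_def mult_ac)
      then show ?thesis by (simp only: Re_of_real_times)
    qed
    have "(cmod (joint_ecf n x y t s - ecf n x t * ecf n y s))\<^sup>2
        = (1 / (real n)\<^sup>2) * (\<Sum>k=1..n. \<Sum>l=1..n. Re (U k l t * V k l s))"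
      unfolding joint_ecf_minus_product[OF n] cmod_sq_mean_of_products U_def V_def ..
    then show "?F z = (case z of (t, s) \<Rightarrow>
        (1 / (real n)\<^sup>2) * (\<Sum>k=1..n. \<Sum>l=1..n. Re (P k l t * Q k l s)))"
      unfolding z prod.case PQ sum_distrib_left[symmetric]
      by (simp add: dcov_weight_def mult_ac del: times_complex.sel)
  qed
  have "has_bochner_integral lborel (\<lambda>z. Re (P k l (fst z) * Q k l (snd z)))
      (double_centered n (pair_dist x) k l * double_centered n (pair_dist y) k l)" for k l
    using has_bochner_integral_bounded_linear[OF bounded_linear_Re
        has_bochner_integral_lborel_times[OF P[of k l] Q[of k l]]]
    by (simp add: case_prod_beta flip: of_real_mult)
  then have int: "has_bochner_integral lborel ?F (dcov_sq n x y)"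
    unfolding F dcov_sq_def case_prod_beta
    by (intro has_bochner_integral_mult_right has_bochner_integral_sum)
  have nn: "?F z \<ge> 0" for z
    using dcov_const_pos by (auto simp: case_prod_beta less_imp_le)
  have "0 \<le> integral\<^sup>L lborel ?F"
    by (rule Bochner_Integration.integral_nonneg) (rule nn)
  then have "dcov_sq n x y \<ge> 0"
    unfolding has_bochner_integral_integral_eq[OF int] .
  moreover have "(\<integral>\<^sup>+z. ennreal (?F z) \<partial>lborel) = ennreal (dcov_sq n x y)"
    using int nn by (subst nn_integral_eq_integral) (auto simp: has_bochner_integral_iff)
  moreover have "weighted_norm_sq (\<lambda>t s. joint_ecf n x y t s - ecf n x t * ecf n y s)
      = (\<integral>\<^sup>+z. ennreal (?F z) \<partial>lborel)"
    unfolding weighted_norm_sq_def by (intro nn_integral_cong) (simp split: prod.split)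
  ultimately show ?thesis by (simp add: enn2ereal_ennreal)
qed

theorem theorem1:
  fixes n :: nat
    and N :: "'a measure"
    and X :: "'a \<Rightarrow> real ^ 'p"
    and Y :: "'a \<Rightarrow> real ^ 'q"
    and M :: "'w measure"
    and XS :: "nat \<Rightarrow> 'w \<Rightarrow> real ^ 'p"
    and YS :: "nat \<Rightarrow> 'w \<Rightarrow> real ^ 'q"
  assumes n: "n > 0"
    and N: "prob_space N"
    and X: "X \<in> borel_measurable N"
    and Y: "Y \<in> borel_measurable N"
    and M: "prob_space M"
    and indep: "prob_space.indep_vars M (\<lambda>_. borel) (\<lambda>k \<omega>. (XS k \<omega>, YS k \<omega>)) {1..n}"
    and ident: "\<And>k. k \<in> {1..n} \<Longrightarrow>
      distr M borel (\<lambda>\<omega>. (XS k \<omega>, YS k \<omega>)) = distr N borel (\<lambda>\<omega>. (X \<omega>, Y \<omega>))"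
  shows "\<forall>\<omega>\<in>space M.
    ereal (dcov_sq n (\<lambda>k. XS k \<omega>) (\<lambda>k. YS k \<omega>)) =
    enn2ereal (weighted_norm_sq (\<lambda>t s.
      joint_ecf n (\<lambda>k. XS k \<omega>) (\<lambda>k. YS k \<omega>) t s
      - ecf n (\<lambda>k. XS k \<omega>) t * ecf n (\<lambda>k. YS k \<omega>) s))"
  using weighted_norm_sq_eq_dcov_sq[OF n] by blast

end
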